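(* Let $B$ be a bidirected multigraph, let $X \subseteq V(B)$ be a vertex set, and let $k \geq 0$ be an integer. Then there exist $k$ pairwise vertex-disjoint $X$-paths in $B$, or there exists a vertex set $Y \subseteq V(B)$ with $|Y| \leq 2k-2$ such that the bidirected multigraph $B - Y$ contains no $X$-path.
   Context: A bidirected multigraph $B$ is a pair $(G,\sigma)$ where $G=(V,E)$ is a finite multigraph without loops (multiple edges allowed) and $\sigma$ is a signing assigning to each half-edge $(v,e)$ (with $v$ an endvertex of the edge $e$) a sign $\sigma(v,e) \in \{+,-\}$. We write $V(B)=V$. For $Y \subseteq V(B)$, $B - Y$ is the bidirected multigraph whose underlying multigraph is $G - Y$ (delete the vertices of $Y$ and all incident edges), with $\sigma$ restricted. A path in $B$ is a path $P = v_0 e_1 v_1 \dots e_\ell v_\ell$ in the underlying multigraph $G$ (distinct vertices) such that at each internal vertex the two half-edges of $P$ there have distinct signs, i.e. $\sigma(v_i, e_i) \neq \sigma(v_i, e_{i+1})$ for all $i \in \{1,\dots,\ell-1\}$. A path is trivial if $\ell=0$. For $X \subseteq V(B)$, an $X$-path is a non-trivial path whose two endvertices lie in $X$ and none of whose other vertices lies in $X$. Paths are disjoint if they share no vertex. *)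

theory Defs
  imports Main
begin

datatype sign = Plus | Minus

text \<open>
  Edges are abstract names carrying a set of endvertices, so that parallel edges are possible.
  The signing is a total function, but only its values on half-edges, i.e. on pairs \<open>v\<close>, \<open>e\<close>
  with \<open>v \<in> ends B e\<close> for an edge \<open>e\<close>, are meaningful.
\<close>

record ('v, 'e) bidirected_multigraph =
  verts :: "'v set"
  edges :: "'e set"
  ends :: "'e \<Rightarrow> 'v set"
  signing :: "'v \<Rightarrow> 'e \<Rightarrow> sign"

definition bidirected :: "('v, 'e) bidirected_multigraph \<Rightarrow> bool" where
  "bidirected B \<longleftrightarrow>
     finite (verts B) \<and> finite (edges B) \<and>
     (\<forall>e \<in> edges B. ends B e \<subseteq> verts B \<and> card (ends B e) = 2)"

definition delete_verts ::
  "('v, 'e) bidirected_multigraph \<Rightarrow> 'v set \<Rightarrow> ('v, 'e) bidirected_multigraph" where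
  "delete_verts B Y =
     B \<lparr> verts := verts B - Y, edges := {e \<in> edges B. ends B e \<inter> Y = {}} \<rparr>"

lemma bidirected_delete_verts: "bidirected B \<Longrightarrow> bidirected (delete_verts B Y)"
  by (auto simp: bidirected_def delete_verts_def)

text \<open>
  The path \<open>v\<^sub>0 e\<^sub>1 v\<^sub>1 \<dots> e\<^sub>l v\<^sub>l\<close> is represented by the pair of its vertex list
  \<open>[v\<^sub>0, \<dots>, v\<^sub>l]\<close> and its edge list \<open>[e\<^sub>1, \<dots>, e\<^sub>l]\<close>; as lists are indexed from 0,
  the edge \<open>e\<^sub>i\<close> is entry \<open>i - 1\<close> of the edge list.
\<close>

type_synonym ('v, 'e) path = "'v list \<times> 'e list"

definition path_verts :: "('v, 'e) path \<Rightarrow> 'v set" where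
  "path_verts P = set (fst P)"

definition is_path :: "('v, 'e) bidirected_multigraph \<Rightarrow> ('v, 'e) path \<Rightarrow> bool" where
  "is_path B P \<longleftrightarrow> (case P of (vs, es) \<Rightarrow>
     length vs = Suc (length es) \<and>
     set vs \<subseteq> verts B \<and> set es \<subseteq> edges B \<and> distinct vs \<and>
     (\<forall>i < length es. ends B (es ! i) = {vs ! i, vs ! Suc i}) \<and>
     (\<forall>i. 1 \<le> i \<and> i < length es \<longrightarrow>
        signing B (vs ! i) (es ! (i - 1)) \<noteq> signing B (vs ! i) (es ! i)))"

definition is_X_path ::
  "('v, 'e) bidirected_multigraph \<Rightarrow> 'v set \<Rightarrow> ('v, 'e) path \<Rightarrow> bool" where
  "is_X_path B X P \<longleftrightarrow> is_path B P \<and> (case P of (vs, es) \<Rightarrow>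
     es \<noteq> [] \<and> hd vs \<in> X \<and> last vs \<in> X \<and>
     (\<forall>v \<in> set vs - {hd vs, last vs}. v \<notin> X))"

end

theory Submission
  imports Defs
begin

text \<open>
  Split every vertex outside \<open>X\<close> into a positive and a negative half joined by an edge. The
  \<open>X\<close>-paths of \<open>B\<close> are then the augmenting paths of the matching formed by these \<open>n\<close> vertex edges,
  so a matching with \<open>n + k\<close> edges yields \<open>k\<close> disjoint \<open>X\<close>-paths. If no such matching exists, the
  Tutte--Berge formula provides a barrier \<open>U\<close> leaving odd classes. Delete the vertices all of whose
  halves lie in \<open>U\<close>, and for each class all but one of the vertices that are in \<open>X\<close> or have their
  other half in \<open>U\<close>. As the number of these vertices is odd for each class, the formula gives the
  bound \<open>2 * k - 2\<close>.
\<close>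

section \<open>Maximum matchings\<close>

definition matching :: "'a set set \<Rightarrow> 'a set set \<Rightarrow> bool" where
  "matching E M \<longleftrightarrow> M \<subseteq> E \<and> pairwise disjnt M"

definition max_matching :: "'a set set \<Rightarrow> 'a set set \<Rightarrow> bool" where
  "max_matching E M \<longleftrightarrow> matching E M \<and> (\<forall>N. matching E N \<longrightarrow> card N \<le> card M)"

lemma max_matching_exists:
  assumes "finite E"
  obtains M where "max_matching E M"
proof -
  have "matching E {}" by (simp add: matching_def)
  moreover have "\<forall>N. matching E N \<longrightarrow> card N < Suc (card E)"
    using assms by (auto simp: matching_def card_mono less_Suc_eq_le)
  ultimately show thesis
    using ex_has_greatest_nat[of "matching E" "{}" card "Suc (card E)"] that
    unfolding max_matching_def by blast
qed

lemma matching_partner_unique: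
  assumes "matching E M" "e \<in> M" "f \<in> M" "x \<in> e" "x \<in> f"
  shows "e = f"
  using assms by (auto simp: matching_def pairwise_def disjnt_iff)

lemma matching_insert:
  assumes "matching E M" "e \<in> E" "e \<inter> \<Union>M = {}"
  shows "matching E (insert e M)"
  using assms by (auto simp: matching_def pairwise_insert disjnt_iff)

lemma matching_subset: "matching E M \<Longrightarrow> N \<subseteq> M \<Longrightarrow> matching E N"
  by (auto simp: matching_def intro: pairwise_subset)

locale finite_graph =
  fixes V :: "'a set" and E :: "'a set set"
  assumes finite_V: "finite V"
    and edge: "e \<in> E \<Longrightarrow> e \<subseteq> V \<and> card e = 2"
begin

lemma finite_E: "finite E"
  using finite_V edge by (meson PowI finite_Pow_iff finite_subset subsetI)

lemma matching_finite: "matching E M \<Longrightarrow> finite M"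
  using finite_E finite_subset by (auto simp: matching_def)

lemma matching_covered_subset: "matching E M \<Longrightarrow> \<Union>M \<subseteq> V"
  using edge by (auto simp: matching_def)

lemma card_covered: "matching E M \<Longrightarrow> card (\<Union>M) = 2 * card M"
proof -
  assume M: "matching E M"
  then have c: "\<And>e. e \<in> M \<Longrightarrow> card e = 2" using edge by (auto simp: matching_def)
  have "card (\<Union>M) = sum card M"
    using M c by (intro card_Union_disjoint) (auto simp: matching_def intro: card_ge_0_finite)
  then show ?thesis using c by simp
qed

text \<open>Places the two ends of an edge in one class of the relation \<open>R\<close> in
  \<open>Tutte_Berge\<close>.\<close>

lemma max_matching_adjacent:
  assumes "max_matching E M" "{x, y} \<in> E"
  shows "x \<in> \<Union>M \<or> y \<in> \<Union>M"
proof (rule ccontr)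
  assume "\<not> ?thesis"
  then have n: "{x, y} \<inter> \<Union>M = {}" by blast
  then have "matching E (insert {x, y} M)"
    using assms by (intro matching_insert) (auto simp: max_matching_def)
  moreover have "{x, y} \<notin> M" using n by auto
  ultimately show False
    using assms(1) matching_finite[of M] by (fastforce simp: max_matching_def)
qed

text \<open>Gallai's lemma. Among the maximum matchings missing \<open>t\<close>, one having most edges in common
  with \<open>M\<close> could still be brought closer to \<open>M\<close> by exchanging one edge.\<close>

lemma Gallai_transitive:
  assumes t: "\<exists>N. max_matching E N \<and> t \<notin> \<Union>N"
    and ut: "\<And>M. max_matching E M \<Longrightarrow> u \<in> \<Union>M \<or> t \<in> \<Union>M"
    and tv: "\<And>M. max_matching E M \<Longrightarrow> t \<in> \<Union>M \<or> v \<in> \<Union>M"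
    and "u \<noteq> v" and M: "max_matching E M"
  shows "u \<in> \<Union>M \<or> v \<in> \<Union>M"
proof (rule ccontr)
  assume "\<not> ?thesis"
  then have u: "u \<notin> \<Union>M" and v: "v \<notin> \<Union>M" by auto
  have finM: "finite M" using M matching_finite by (auto simp: max_matching_def)
  let ?Q = "\<lambda>N. max_matching E N \<and> t \<notin> \<Union>N"
  have "\<forall>N. ?Q N \<longrightarrow> card (M \<inter> N) < Suc (card M)"
    using finM by (simp add: card_mono less_Suc_eq_le)
  moreover obtain N\<^sub>0 where "?Q N\<^sub>0" using t by blast
  ultimately have "\<exists>N. ?Q N \<and> (\<forall>N'. ?Q N' \<longrightarrow> card (M \<inter> N') \<le> card (M \<inter> N))"
    by (intro ex_has_greatest_nat)
  then obtain N where N: "max_matching E N" "t \<notin> \<Union>N"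
    and best: "\<And>N'. ?Q N' \<Longrightarrow> card (M \<inter> N') \<le> card (M \<inter> N)"
    by blast
  have mM: "matching E M" and mN: "matching E N" using M N by (auto simp: max_matching_def)
  have finN: "finite N" using mN matching_finite by blast
  have "card M = card N"
    using M N by (auto simp: max_matching_def intro: antisym)
  then have same: "card (\<Union>M) = card (\<Union>N)" using card_covered mM mN by simp
  have finU: "finite (\<Union>N)" using matching_covered_subset[OF mN] finite_V finite_subset by blast
  have uv: "u \<in> \<Union>N" "v \<in> \<Union>N" using ut[OF N(1)] tv[OF N(1)] N(2) by auto
  \<comment> \<open>\<open>M\<close> and \<open>N\<close> cover equally many vertices, but
    \<open>N\<close> covers \<open>u\<close> and \<open>v\<close> and \<open>M\<close> neither. So
    \<open>M\<close> covers at least two vertices missed by \<open>N\<close>, one of them different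
    from \<open>t\<close>.\<close>
  have "\<not> \<Union>M \<subseteq> insert t (\<Union>N - {u, v})"
  proof
    assume "\<Union>M \<subseteq> insert t (\<Union>N - {u, v})"
    then have "card (\<Union>M) \<le> card (insert t (\<Union>N - {u, v}))"
      using finU by (intro card_mono) auto
    also have "\<dots> \<le> Suc (card (\<Union>N - {u, v}))" by (simp add: card_insert_le_m1 finU card_insert_if)
    also have "card (\<Union>N - {u, v}) = card (\<Union>N) - 2"
      using uv \<open>u \<noteq> v\<close> by (subst card_Diff_subset) auto
    finally have "card (\<Union>N) \<le> Suc (card (\<Union>N) - 2)" using same by simp
    \<comment> \<open>Ensures that the subtraction of 2 is not truncated.\<close>
    moreover have "card {u, v} \<le> card (\<Union>N)" using uv finU by (intro card_mono) auto
    ultimately show False using \<open>u \<noteq> v\<close> by simp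
  qed
  then obtain x where x: "x \<in> \<Union>M" "x \<notin> \<Union>N" "x \<noteq> t" using u v by blast
  then obtain d where d: "d \<in> M" "x \<in> d" by blast
  then have "d \<in> E" using mM by (auto simp: matching_def)
  then obtain y where y: "d = {x, y}" "x \<noteq> y"
    using edge d(2) by (metis card_2_iff doubleton_eq_iff insertE singletonD)
  have "y \<in> \<Union>N" using max_matching_adjacent[OF N(1)] x y \<open>d \<in> E\<close> by blast
  then obtain e where e: "e \<in> N" "y \<in> e" by blast
  have "e \<notin> M"
  proof
    assume "e \<in> M"
    then have "d = e" using matching_partner_unique[OF mM d(1)] e(2) y(1) by blast
    then show False using e(1) d(2) x(2) by blast
  qed
  \<comment> \<open>The exchange trades \<open>e\<close>, which is not in \<open>M\<close>, for
    \<open>d\<close>, which is. It still avoids \<open>t\<close>, because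
    \<open>x \<noteq> t\<close> and \<open>y\<close> is covered by \<open>N\<close>.\<close>
  let ?N = "insert d (N - {e})"
  have "matching E ?N"
  proof (rule matching_insert[OF matching_subset[OF mN] \<open>d \<in> E\<close>])
    show "d \<inter> \<Union>(N - {e}) = {}"
      using matching_partner_unique[OF mN e(1) _ e(2)] x(2) y(1) by blast
  qed auto
  moreover have "d \<notin> N" using x d by blast
  then have "card ?N = card N"
    using card.remove[OF finN e(1)] finN by (simp del: card_Diff_singleton card_Diff_insert)
  ultimately have "max_matching E ?N" using N(1) by (simp add: max_matching_def)
  moreover have "t \<notin> \<Union>?N" using N(2) x(3) y \<open>y \<in> \<Union>N\<close> by blast
  moreover have "M \<inter> ?N = insert d (M \<inter> N)" using d(1) \<open>e \<notin> M\<close> by auto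
  ultimately show False using best[of ?N] \<open>d \<notin> N\<close> finM by simp
qed

end

text \<open>The nontrivial direction of the Tutte--Berge formula. Deleting vertices which every maximum
  matching covers leads to the situation of Gallai's lemma, where all maximum matchings miss
  exactly one vertex of each equivalence class.\<close>

theorem Tutte_Berge:
  assumes "finite_graph V E" "max_matching E M"
  shows "\<exists>U P. U \<subseteq> V \<and> \<Union>P = V - U \<and> pairwise disjnt P \<and> (\<forall>K\<in>P. odd (card K)) \<and>
    (\<forall>e\<in>E. e \<inter> U = {} \<longrightarrow> (\<exists>K\<in>P. e \<subseteq> K)) \<and> card V + card U = 2 * card M + card P"
  using assms
proof (induction "card V" arbitrary: V E M rule: less_induct)
  case less
  interpret finite_graph V E by fact
  have mM: "matching E M" using less.prems by (simp add: max_matching_def)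
  show ?case
  proof (cases "\<exists>v\<in>V. \<forall>N. max_matching E N \<longrightarrow> v \<in> \<Union>N")
    case True
    then obtain v where v: "v \<in> V" and cov: "\<And>N. max_matching E N \<Longrightarrow> v \<in> \<Union>N" by blast
    define E' where "E' = {e \<in> E. v \<notin> e}"
    obtain d where d: "d \<in> M" "v \<in> d" using cov[OF less.prems(2)] by blast
    have g': "finite_graph (V - {v}) E'"
      using finite_V edge by unfold_locales (auto simp: E'_def)
    have "matching E' (M - {d})"
      using matching_partner_unique[OF mM d(1)] mM d(2)
      by (auto simp: matching_def E'_def pairwise_def)
    moreover have finM: "finite M" using mM by (rule matching_finite)
    \<comment> \<open>A matching avoiding \<open>v\<close> is not maximum, so deleting
      \<open>v\<close> lowers the matching number by exactly one. Moving \<open>v\<close> into the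
      barrier then raises both sides of the formula by two.\<close>
    moreover have "card N \<le> card (M - {d})" if N: "matching E' N" for N
    proof -
      have "matching E N" "v \<notin> \<Union>N" using N by (auto simp: matching_def E'_def)
      then have "\<not> max_matching E N" using cov by blast
      then have "card N < card M"
        using \<open>matching E N\<close> less.prems(2) by (meson max_matching_def le_trans not_le)
      then show ?thesis using d(1) finM by simp
    qed
    ultimately have mx: "max_matching E' (M - {d})" by (simp add: max_matching_def)
    have "card (V - {v}) < card V" using v finite_V by (rule card_Diff1_less[rotated])
    then obtain U P where
      UP: "U \<subseteq> V - {v}" "\<Union>P = V - {v} - U" "pairwise disjnt P" "\<forall>K\<in>P. odd (card K)"
        "\<forall>e\<in>E'. e \<inter> U = {} \<longrightarrow> (\<exists>K\<in>P. e \<subseteq> K)"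
        "card (V - {v}) + card U = 2 * card (M - {d}) + card P"
      using less.hyps[OF _ g' mx] that by meson
    have "card M > 0" "card V > 0" using d(1) finM v finite_V by (auto simp: card_gt_0_iff)
    moreover have "card (insert v U) = Suc (card U)"
      using UP(1) finite_V finite_subset[OF UP(1)] by (auto simp: card_insert_if)
    ultimately have "card V + card (insert v U) = 2 * card M + card P"
      using UP(6) d(1) v by simp
    then show ?thesis
      using UP v by (intro exI[of _ "insert v U"] exI[of _ P]) (auto simp: E'_def)
  next
    case False
    then have missed: "\<exists>N. max_matching E N \<and> v \<notin> \<Union>N" if "v \<in> V" for v using that by blast
    \<comment> \<open>Distinct vertices are related if no maximum matching misses both. Gallai's
      lemma gives transitivity, as every vertex is now missed by some maximum matching.\<close>
    define R where "R = {(u, v). u \<in> V \<and> v \<in> V \<and>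
      (u = v \<or> (\<forall>N. max_matching E N \<longrightarrow> u \<in> \<Union>N \<or> v \<in> \<Union>N))}"
    have eq: "equiv V R"
    proof (intro equivI transI)
      show "R \<subseteq> V \<times> V" "refl_on V R" "sym R" by (auto simp: R_def refl_on_def sym_def)
    next
      fix u t v assume "(u, t) \<in> R" "(t, v) \<in> R"
      then show "(u, v) \<in> R"
        using Gallai_transitive[OF missed, of t u v] unfolding R_def by blast
    qed
    define P where "P = V // R"
    have P: "\<Union>P = V" using eq by (simp add: P_def Union_quotient)
    have disj: "K = L" if "K \<in> P" "L \<in> P" "x \<in> K" "x \<in> L" for K L x
      using quotient_disj[OF eq, of K L] that by (auto simp: P_def)
    have R_class: "(x, y) \<in> R \<longleftrightarrow> y \<in> K" if "K \<in> P" "x \<in> K" for x y K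
      using that in_quotient_imp_closed[OF eq, of K x y] in_quotient_imp_in_rel[OF eq, of K x y]
      unfolding P_def by blast
    have edge_class: "\<exists>K\<in>P. e \<subseteq> K" if "e \<in> E" for e
    proof -
      obtain x y where e: "e = {x, y}" using edge \<open>e \<in> E\<close> by (meson card_2_iff)
      then have "(x, y) \<in> R"
        using max_matching_adjacent[of _ x y] edge \<open>e \<in> E\<close> by (fastforce simp: R_def)
      moreover obtain K where "K \<in> P" "x \<in> K" using P e edge \<open>e \<in> E\<close> by blast
      ultimately show ?thesis using R_class e by blast
    qed
    have one_missed: "\<exists>v. K - \<Union>N = {v}"
      if K: "K \<in> P" and N: "max_matching E N" and v: "v \<in> K" "v \<notin> \<Union>N" for K v N
    proof -
      have "x = v" if x: "x \<in> K" "x \<notin> \<Union>N" for x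
      proof -
        have "(v, x) \<in> R" using R_class[OF K v(1)] x(1) by simp
        then show ?thesis using N v(2) x(2) by (auto simp: R_def)
      qed
      then show ?thesis using v by blast
    qed
    \<comment> \<open>No edge leaves its class, so a matching covers an even number of vertices in
      each class. With \<open>one_missed\<close> this makes the classes odd, and oddness in turn
      forces \<open>M\<close> to miss a vertex of each.\<close>
    have class_covered: "card (K \<inter> \<Union>N) = 2 * card {e \<in> N. e \<subseteq> K}"
      if K: "K \<in> P" and N: "matching E N" for K N
    proof -
      have "K \<inter> \<Union>N \<subseteq> \<Union>{e \<in> N. e \<subseteq> K}"
      proof
        fix x assume "x \<in> K \<inter> \<Union>N"
        then obtain e where e: "e \<in> N" "x \<in> e" "x \<in> K" by blast
        then have "e \<in> E" using N by (auto simp: matching_def)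
        then obtain L where "L \<in> P" "e \<subseteq> L" using edge_class by blast
        then show "x \<in> \<Union>{e \<in> N. e \<subseteq> K}" using e disj[OF K, of L x] by blast
      qed
      then have "K \<inter> \<Union>N = \<Union>{e \<in> N. e \<subseteq> K}" by blast
      moreover have "matching E {e \<in> N. e \<subseteq> K}" using N by (rule matching_subset) auto
      ultimately show ?thesis using card_covered by simp
    qed
    have odd: "odd (card K)" if K: "K \<in> P" for K
    proof -
      have "K \<noteq> {}" using K in_quotient_imp_non_empty[OF eq] by (simp add: P_def)
      moreover have "K \<subseteq> V" using K P by blast
      ultimately obtain v N where v: "v \<in> K" "max_matching E N" "v \<notin> \<Union>N"
        using missed by blast
      then obtain w where w: "K - \<Union>N = {w}" using one_missed[OF K] by blast
      have "finite K" using \<open>K \<subseteq> V\<close> finite_V finite_subset by blast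
      moreover have "K = insert w (K \<inter> \<Union>N)" "w \<notin> \<Union>N" using w by auto
      ultimately have "card K = Suc (card (K \<inter> \<Union>N))"
        by (metis IntD2 card_insert_disjoint finite_Int)
      then show ?thesis using class_covered[OF K, of N] v(2) by (simp add: max_matching_def)
    qed
    have miss_some: "\<exists>v. K - \<Union>M = {v}" if K: "K \<in> P" for K
    proof (rule ccontr)
      assume "\<nexists>v. K - \<Union>M = {v}"
      then have "K \<inter> \<Union>M = K" using one_missed[OF K less.prems(2)] by blast
      then show False using class_covered[OF K mM] odd[OF K] by simp
    qed
    \<comment> \<open>The classes correspond to the vertices missed by \<open>M\<close>, so the
      formula holds with empty barrier.\<close>
    have "bij_betw (\<lambda>K. the_elem (K - \<Union>M)) P (V - \<Union>M)"
    proof (rule bij_betw_imageI)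
      have el: "the_elem (K - \<Union>M) \<in> K - \<Union>M" if "K \<in> P" for K
        using miss_some[OF that] by (metis insertI1 the_elem_eq)
      show "inj_on (\<lambda>K. the_elem (K - \<Union>M)) P"
        using el disj by (intro inj_onI) (metis DiffD1)
      show "(\<lambda>K. the_elem (K - \<Union>M)) ` P = V - \<Union>M"
      proof safe
        fix K assume "K \<in> P"
        then show "the_elem (K - \<Union>M) \<in> V" using el P by blast
      next
        fix K e assume "K \<in> P" "e \<in> M" "the_elem (K - \<Union>M) \<in> e"
        then show False using el by blast
      next
        fix x assume x: "x \<in> V" "x \<notin> \<Union>M"
        then obtain K where K: "K \<in> P" "x \<in> K" using P by blast
        obtain w where w: "K - \<Union>M = {w}" using miss_some[OF K(1)] by blast
        have "x \<in> K - \<Union>M" using K(2) x(2) by (rule DiffI)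
        then have "x = the_elem (K - \<Union>M)" unfolding w the_elem_eq by (rule singletonD)
        then show "x \<in> (\<lambda>K. the_elem (K - \<Union>M)) ` P" using K(1) by (rule image_eqI)
      qed
    qed
    then have "card P = card (V - \<Union>M)" by (rule bij_betw_same_card)
    moreover have "card (V - \<Union>M) = card V - 2 * card M"
      using matching_covered_subset[OF mM] card_covered[OF mM] finite_V
      by (metis card_Diff_subset finite_subset)
    moreover have "2 * card M \<le> card V"
      using card_mono[OF finite_V matching_covered_subset[OF mM]] card_covered[OF mM] by simp
    ultimately have "card V + card {} = 2 * card M + card P" by simp
    moreover have "pairwise disjnt P" using disj by (auto simp: pairwise_def disjnt_iff)
    ultimately show ?thesis
      using P odd edge_class by (intro exI[of _ "{}"] exI[of _ P]) auto
  qed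
qed

section \<open>Paths in bidirected multigraphs\<close>

lemma UNIV_sign: "UNIV = {Plus, Minus}"
  using sign.exhaust by blast

fun opposite :: "sign \<Rightarrow> sign" where
  "opposite Plus = Minus"
| "opposite Minus = Plus"

lemma opposite_opposite [simp]: "opposite (opposite s) = s"
  by (cases s) auto

lemma opposite_neq [simp]: "opposite s \<noteq> s" "s \<noteq> opposite s"
  by (cases s; simp)+

lemma sign_neq_iff: "s \<noteq> t \<longleftrightarrow> t = opposite s"
  by (cases s; cases t) auto

text \<open>Shifts the index in the sign condition so that no subtraction occurs.\<close>

lemma is_path_iff:
  "is_path B (vs, es) \<longleftrightarrow>
     length vs = Suc (length es) \<and> set vs \<subseteq> verts B \<and> set es \<subseteq> edges B \<and> distinct vs \<and>
     (\<forall>i < length es. ends B (es ! i) = {vs ! i, vs ! Suc i}) \<and>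
     (\<forall>i. Suc i < length es \<longrightarrow>
        signing B (vs ! Suc i) (es ! i) \<noteq> signing B (vs ! Suc i) (es ! Suc i))"
proof -
  have "(\<forall>i. 1 \<le> i \<and> i < length es \<longrightarrow> Q i (i - 1)) \<longleftrightarrow> (\<forall>i. Suc i < length es \<longrightarrow> Q (Suc i) i)"
    for Q
    by (metis One_nat_def Suc_le_D diff_Suc_1 le_add1 plus_1_eq_Suc)
  from this[of "\<lambda>i j. signing B (vs ! i) (es ! j) \<noteq> signing B (vs ! i) (es ! i)"]
  show ?thesis by (simp add: is_path_def)
qed

lemma is_path_rev:
  assumes "is_path B (vs, es)"
  shows "is_path B (rev vs, rev es)"
proof -
  have p: "length vs = Suc (length es)" "set vs \<subseteq> verts B" "set es \<subseteq> edges B" "distinct vs"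
    and en: "\<And>i. i < length es \<Longrightarrow> ends B (es ! i) = {vs ! i, vs ! Suc i}"
    and sg: "\<And>i. Suc i < length es \<Longrightarrow>
        signing B (vs ! Suc i) (es ! i) \<noteq> signing B (vs ! Suc i) (es ! Suc i)"
    using assms by (auto simp: is_path_iff)
  have "ends B (rev es ! i) = {rev vs ! i, rev vs ! Suc i}" if "i < length es" for i
    using that en[of "length es - Suc i"] p(1) by (auto simp: rev_nth Suc_diff_Suc)
  moreover have "signing B (rev vs ! Suc i) (rev es ! i) \<noteq> signing B (rev vs ! Suc i) (rev es ! Suc i)"
    if "Suc i < length es" for i
  proof -
    have "Suc (length es - Suc (Suc i)) = length es - Suc i" "length es - Suc i < length es"
      using that by simp_all
    then show ?thesis using that sg[of "length es - Suc (Suc i)"] p(1) by (simp add: rev_nth)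
  qed
  ultimately show ?thesis using p by (simp add: is_path_iff)
qed

text \<open>Only the sign condition at the junction \<open>v\<close> is not inherited from the two
  parts.\<close>

lemma is_path_append:
  assumes "is_path B (vs, es)" "is_path B (ws, fs)" "es \<noteq> []" "fs \<noteq> []"
    and v: "last vs = v" "hd ws = v"
    and "signing B v (last es) \<noteq> signing B v (hd fs)"
    and "set vs \<inter> set ws = {v}"
  shows "is_path B (vs @ tl ws, es @ fs)"
proof -
  have p: "length vs = Suc (length es)" "set vs \<subseteq> verts B" "set es \<subseteq> edges B" "distinct vs"
    and en: "\<And>i. i < length es \<Longrightarrow> ends B (es ! i) = {vs ! i, vs ! Suc i}"
    and sg: "\<And>i. Suc i < length es \<Longrightarrow>
        signing B (vs ! Suc i) (es ! i) \<noteq> signing B (vs ! Suc i) (es ! Suc i)"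
    using assms(1) by (auto simp: is_path_iff)
  have q: "length ws = Suc (length fs)" "set ws \<subseteq> verts B" "set fs \<subseteq> edges B" "distinct ws"
    and en': "\<And>i. i < length fs \<Longrightarrow> ends B (fs ! i) = {ws ! i, ws ! Suc i}"
    and sg': "\<And>i. Suc i < length fs \<Longrightarrow>
        signing B (ws ! Suc i) (fs ! i) \<noteq> signing B (ws ! Suc i) (fs ! Suc i)"
    using assms(2) by (auto simp: is_path_iff)
  let ?l = "length es"
  obtain ws' where ws: "ws = v # ws'" using v q(1) by (cases ws) auto
  \<comment> \<open>The ranges of \<open>nth1\<close> and \<open>nth2\<close> overlap at
    \<open>?l\<close>, because \<open>vs\<close> ends where \<open>ws\<close> starts.\<close>
  have nth1: "(vs @ ws') ! i = vs ! i" if "i \<le> ?l" for i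
    using that p(1) by (simp add: nth_append)
  have "vs ! ?l = v" using v(1) p(1) by (metis diff_Suc_1 last_conv_nth length_0_conv nat.distinct(1))
  then have nth2: "(vs @ ws') ! i = ws ! (i - ?l)" if "?l \<le> i" for i
    using that p(1) ws by (cases "i = ?l") (auto simp: nth_append nth_Cons' less_Suc_eq)
  have "ends B ((es @ fs) ! i) = {(vs @ ws') ! i, (vs @ ws') ! Suc i}"
    if "i < length (es @ fs)" for i
  proof (cases "i < ?l")
    case True
    then show ?thesis using en nth1 by (simp add: nth_append)
  next
    case False
    then show ?thesis using that en'[of "i - ?l"] nth2 by (simp add: nth_append Suc_diff_le)
  qed
  moreover have "signing B ((vs @ ws') ! Suc i) ((es @ fs) ! i) \<noteq>
      signing B ((vs @ ws') ! Suc i) ((es @ fs) ! Suc i)"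
    if "Suc i < length (es @ fs)" for i
  proof -
    consider "Suc i < ?l" | "Suc i = ?l" | "?l \<le> i" by linarith
    then show ?thesis
    proof cases
      case 1
      then show ?thesis using sg nth1 by (simp add: nth_append)
    next
      case 2
      then have "es ! i = last es" "fs ! 0 = hd fs"
        using assms(3,4) by (simp_all add: last_conv_nth hd_conv_nth flip: 2)
      then show ?thesis
        using 2 assms(7) nth1[of "Suc i"] \<open>vs ! ?l = v\<close> by (auto simp: nth_append)
    next
      case 3
      then show ?thesis using that sg'[of "i - ?l"] nth2 by (simp add: nth_append Suc_diff_le)
    qed
  qed
  moreover have "distinct (vs @ ws')" using p(4) q(4) ws assms(8) by auto
  moreover have "length (vs @ ws') = Suc (length (es @ fs))" using p(1) q(1) ws by simp
  moreover have "set (vs @ ws') \<subseteq> verts B" "set (es @ fs) \<subseteq> edges B"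
    using p q ws by auto
  ultimately show ?thesis unfolding is_path_iff ws list.sel by blast
qed

section \<open>The split graph\<close>

text \<open>Every vertex outside \<open>X\<close> is split into its two halves, which are joined by an edge;
  a vertex in \<open>X\<close> has the single half with sign \<open>Plus\<close>.\<close>

locale terminals =
  fixes B :: "('v, 'e) bidirected_multigraph" and X :: "'v set"
  assumes bidirected: "bidirected B" and X_verts: "X \<subseteq> verts B"
begin

definition half :: "'v \<Rightarrow> sign \<Rightarrow> 'v \<times> sign" where
  "half v s = (v, if v \<in> X then Plus else s)"

text \<open>Fixes the single half of a vertex in \<open>X\<close>, which makes it an involution on
  all of \<open>halves\<close>.\<close>

definition flip :: "'v \<times> sign \<Rightarrow> 'v \<times> sign" where
  "flip p = half (fst p) (opposite (snd p))"

definition halves :: "('v \<times> sign) set" where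
  "halves = X \<times> {Plus} \<union> (verts B - X) \<times> UNIV"

definition vertex_edge :: "'v \<Rightarrow> ('v \<times> sign) set" where
  "vertex_edge v = {(v, Plus), (v, Minus)}"

text \<open>At an inner vertex outside \<open>X\<close>, the sign condition says that a path arrives
  at one half and leaves at the other. Hence \<open>X\<close>-paths alternate between the two kinds
  of edges. Parallel edges with the same end halves are identified.\<close>

definition split_edges :: "('v \<times> sign) set set" where
  "split_edges =
     {{half u (signing B u e), half v (signing B v e)} | e u v. e \<in> edges B \<and> ends B e = {u, v}} \<union>
     vertex_edge ` (verts B - X)"

lemma fst_half [simp]: "fst (half v s) = v"
  by (simp add: half_def)

lemma half_X: "v \<in> X \<Longrightarrow> half v s = (v, Plus)"
  by (simp add: half_def)

lemma half_not_X [simp]: "v \<notin> X \<Longrightarrow> half v s = (v, s)"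
  by (simp add: half_def)

lemma half_in_halves [simp]: "half v s \<in> halves \<longleftrightarrow> v \<in> verts B"
  using X_verts by (auto simp: half_def halves_def)

lemma fst_flip [simp]: "fst (flip p) = fst p"
  by (simp add: flip_def)

lemma flip_flip: "p \<in> halves \<Longrightarrow> flip (flip p) = p"
  by (auto simp: flip_def half_def halves_def)

lemma vertex_edge_flip: "fst p \<notin> X \<Longrightarrow> vertex_edge (fst p) = {p, flip p}"
  by (cases p; cases "snd p") (auto simp: vertex_edge_def flip_def half_def)

lemma finite_verts: "finite (verts B)"
  using bidirected by (simp add: bidirected_def)

lemma finite_X: "finite X"
  using finite_verts X_verts finite_subset by blast

lemma ends_edge:
  assumes "e \<in> edges B" "ends B e = {u, v}"
  shows "u \<noteq> v" "u \<in> verts B" "v \<in> verts B"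
proof -
  have "{u, v} \<subseteq> verts B \<and> card {u, v} = 2"
    using assms bidirected unfolding bidirected_def by metis
  then show "u \<noteq> v" "u \<in> verts B" "v \<in> verts B" by auto
qed

lemma finite_halves: "finite halves"
  using finite_verts finite_X by (simp add: halves_def UNIV_sign)

lemma card_halves: "card halves = card X + 2 * card (verts B - X)"
proof -
  have "card halves = card (X \<times> {Plus}) + card ((verts B - X) \<times> (UNIV :: sign set))"
    unfolding halves_def using finite_verts finite_X
    by (intro card_Un_disjoint) (auto simp: UNIV_sign)
  then show ?thesis by (simp add: card_cartesian_product UNIV_sign)
qed

lemma finite_graph_split: "finite_graph halves split_edges"
proof
  show "finite halves" by (rule finite_halves)
next
  fix d assume "d \<in> split_edges"
  then consider (edge) e u v where "d = {half u (signing B u e), half v (signing B v e)}"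
      "e \<in> edges B" "ends B e = {u, v}"
    | (vertex) v where "v \<in> verts B - X" "d = vertex_edge v"
    unfolding split_edges_def by blast
  then show "d \<subseteq> halves \<and> card d = 2"
  proof cases
    case edge
    moreover have "half u (signing B u e) \<noteq> half v (signing B v e)"
      using ends_edge(1)[OF edge(2,3)] by (metis fst_half)
    ultimately show ?thesis using ends_edge[OF edge(2,3)] by simp
  next
    case vertex
    then show ?thesis by (auto simp: vertex_edge_def halves_def)
  qed
qed

section \<open>Links: paths seen through their end halves\<close>

text \<open>The edges are forgotten: continuing a path depends only on its end halves, disjointness
  only on its vertices.\<close>

definition link :: "'v \<times> sign \<Rightarrow> 'v set \<Rightarrow> 'v \<times> sign \<Rightarrow> bool" where
  "link a I b \<longleftrightarrow> (\<exists>vs es. is_path B (vs, es) \<and> es \<noteq> [] \<and>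
     half (hd vs) (signing B (hd vs) (hd es)) = a \<and>
     half (last vs) (signing B (last vs) (last es)) = b \<and> I = set vs - {hd vs, last vs})"

lemma link_edge:
  assumes "e \<in> edges B" "ends B e = {u, v}"
  shows "link (half u (signing B u e)) {} (half v (signing B v e))"
  unfolding link_def using ends_edge[OF assms] assms
  by (intro exI[of _ "[u, v]"] exI[of _ "[e]"]) (auto simp: is_path_iff)

lemma link_sym:
  assumes "link a I b"
  shows "link b I a"
proof -
  obtain vs es where p: "is_path B (vs, es)" "es \<noteq> []"
    "half (hd vs) (signing B (hd vs) (hd es)) = a"
    "half (last vs) (signing B (last vs) (last es)) = b" "I = set vs - {hd vs, last vs}"
    using assms by (auto simp: link_def)
  have "vs \<noteq> []" using p(1) by (auto simp: is_path_iff)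
  then show ?thesis
    unfolding link_def using p is_path_rev[OF p(1)]
    by (intro exI[of _ "rev vs"] exI[of _ "rev es"]) (auto simp: hd_rev last_rev)
qed

lemma link_ends:
  assumes "link a I b"
  shows "fst a \<noteq> fst b" "a \<in> halves" "b \<in> halves" "I \<subseteq> verts B - {fst a, fst b}"
proof -
  obtain vs es where p: "is_path B (vs, es)" "es \<noteq> []"
    "half (hd vs) (signing B (hd vs) (hd es)) = a"
    "half (last vs) (signing B (last vs) (last es)) = b" "I = set vs - {hd vs, last vs}"
    using assms by (auto simp: link_def)
  have vs: "vs \<noteq> []" "distinct vs" "set vs \<subseteq> verts B" "length vs = Suc (length es)"
    using p(1) by (auto simp: is_path_iff)
  have "hd vs = vs ! 0" "last vs = vs ! length es"
    using vs by (simp_all add: hd_conv_nth last_conv_nth)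
  then show "fst a \<noteq> fst b"
    using p(2) vs by (simp add: nth_eq_iff_index_eq flip: p(3,4))
  show "a \<in> halves" "b \<in> halves" using vs(1,3) by (auto simp flip: p(3,4))
  show "I \<subseteq> verts B - {fst a, fst b}" using vs(3) p(5) by (auto simp flip: p(3,4))
qed

text \<open>As \<open>v\<close> is outside \<open>X\<close>, its halves show the actual signs, so
  \<open>s \<noteq> t\<close> is the path condition at the junction. The disjointness assumption
  includes the far ends and thus excludes closing a cycle.\<close>

lemma link_join:
  assumes "link a I (v, s)" "link (v, t) J b" "s \<noteq> t" "v \<notin> X"
    and "insert (fst a) I \<inter> insert (fst b) J = {}"
  shows "link a (insert v (I \<union> J)) b"
proof -
  obtain vs es where p: "is_path B (vs, es)" "es \<noteq> []"
    "half (hd vs) (signing B (hd vs) (hd es)) = a"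
    "half (last vs) (signing B (last vs) (last es)) = (v, s)" "I = set vs - {hd vs, last vs}"
    using assms(1) by (auto simp: link_def)
  obtain ws fs where q: "is_path B (ws, fs)" "fs \<noteq> []"
    "half (hd ws) (signing B (hd ws) (hd fs)) = (v, t)"
    "half (last ws) (signing B (last ws) (last fs)) = b" "J = set ws - {hd ws, last ws}"
    using assms(2) by (auto simp: link_def)
  have ne: "vs \<noteq> []" "ws \<noteq> []" "tl ws \<noteq> []"
    using p(1) q(1,2) by (cases ws; cases vs; cases fs; auto simp: is_path_iff)+
  have v: "last vs = v" "hd ws = v" using p(4) q(3) by (auto simp: half_def)
  have s: "signing B v (last es) = s" "signing B v (hd fs) = t"
    using p(4) q(3) v assms(4) by auto
  have e: "fst a = hd vs" "fst b = last ws" using p(3) q(4) by auto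
  have sets: "set vs = insert v (insert (fst a) I)" "set ws = insert v (insert (fst b) J)"
    using p(5) q(5) e v ne hd_in_set[of ws] by auto
  have "fst a \<noteq> v" "fst b \<noteq> v" "v \<notin> I" "v \<notin> J"
    using link_ends[OF assms(1)] link_ends[OF assms(2)] by auto
  moreover have "set (tl ws) = set ws - {v}"
    using q(1) ne(2) v(2) by (cases ws) (auto simp: is_path_iff)
  ultimately have "set (vs @ tl ws) - {fst a, fst b} = insert v (I \<union> J)"
    using sets assms(5) link_ends(4)[OF assms(1)] link_ends(4)[OF assms(2)] by auto
  moreover have "is_path B (vs @ tl ws, es @ fs)"
    using p(1,2) q(1,2) v s assms(3,5) sets by (intro is_path_append[where v = v]) auto
  moreover have "hd (vs @ tl ws) = fst a" "last (vs @ tl ws) = fst b"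
    using e ne by (simp_all add: last_tl)
  ultimately show ?thesis
    unfolding link_def using p(2,3) q(2,4) e
    by (intro exI[of _ "vs @ tl ws"] exI[of _ "es @ fs"]) simp
qed

lemma link_X_path:
  assumes "link a I b" "fst a \<in> X" "fst b \<in> X" "I \<inter> X = {}"
  shows "\<exists>Q. is_X_path B X Q \<and> path_verts Q = insert (fst a) (insert (fst b) I)"
proof -
  obtain vs es where p: "is_path B (vs, es)" "es \<noteq> []"
    "half (hd vs) (signing B (hd vs) (hd es)) = a"
    "half (last vs) (signing B (last vs) (last es)) = b" "I = set vs - {hd vs, last vs}"
    using assms(1) by (auto simp: link_def)
  have "vs \<noteq> []" using p(1) by (auto simp: is_path_iff)
  moreover have "fst a = hd vs" "fst b = last vs" using p(3,4) by auto
  ultimately have "is_X_path B X (vs, es)" "path_verts (vs, es) = insert (fst a) (insert (fst b) I)"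
    using p assms by (auto simp: is_X_path_def path_verts_def)
  then show ?thesis by blast
qed

section \<open>Disjoint paths from a large matching\<close>

definition linked :: "('v \<times> sign) set \<Rightarrow> 'v set \<Rightarrow> bool" where
  "linked D I \<longleftrightarrow> (\<exists>a b. D = {a, b} \<and> link a I b)"

lemma linked_in:
  assumes "linked D I" "a \<in> D"
  obtains b where "D = {a, b}" "link a I b"
  using assms link_sym unfolding linked_def by (metis insertE insert_commute singletonD)

lemma linked_ends:
  assumes "linked D I"
  shows "D \<noteq> {}" "D \<subseteq> halves"
  using assms link_ends unfolding linked_def by fastforce+

text \<open>A linkage is a family of disjoint links, each given by its two end halves and its set of
  inner vertices, where \<open>W\<close> contains the inner vertices and no endvertices. A matching of the split
  graph is one in which no link has inner vertices, and \<open>W\<close> is where it uses the vertex edges.\<close>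

definition linkage :: "(('v \<times> sign) set \<times> 'v set) set \<Rightarrow> 'v set \<Rightarrow> bool" where
  "linkage F W \<longleftrightarrow> finite F \<and> W \<subseteq> verts B - X \<and>
     (\<forall>p\<in>F. linked (fst p) (snd p) \<and> snd p \<subseteq> W \<and> fst ` fst p \<inter> W = {}) \<and>
     pairwise (\<lambda>p q. disjnt (fst p) (fst q) \<and> disjnt (snd p) (snd q)) F"

text \<open>Starts the construction; the extension steps never decrease
  \<open>card F + card W\<close>.\<close>

lemma linkage_from_matching:
  assumes M: "matching split_edges M"
  obtains F W where "linkage F W" "card M = card F + card W"
proof -
  interpret finite_graph halves split_edges by (rule finite_graph_split)
  define W where "W = {v \<in> verts B - X. vertex_edge v \<in> M}"
  define N where "N = M - vertex_edge ` W"
  have fin: "finite M" "finite W" using matching_finite[OF M] finite_verts by (auto simp: W_def)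
  have "linked d {} \<and> fst ` d \<inter> W = {}" if "d \<in> N" for d
  proof
    have d: "d \<in> M" "d \<notin> vertex_edge ` W" using that by (auto simp: N_def)
    then have "d \<in> split_edges" using M by (auto simp: matching_def)
    moreover have "d \<notin> vertex_edge ` (verts B - X)" using d by (auto simp: W_def)
    ultimately show "linked d {}"
      using link_edge unfolding split_edges_def linked_def by blast
    show "fst ` d \<inter> W = {}"
    proof (rule ccontr)
      assume "fst ` d \<inter> W \<noteq> {}"
      then obtain v s where v: "(v, s) \<in> d" "v \<in> W" by auto
      then have "(v, s) \<in> vertex_edge v" by (cases s) (auto simp: vertex_edge_def)
      then have "d = vertex_edge v"
        using matching_partner_unique[OF M d(1)] v by (auto simp: W_def)
      then show False using d(2) v(2) by blast
    qed
  qed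
  moreover have "pairwise disjnt N" using M by (auto simp: matching_def N_def pairwise_def)
  ultimately have "linkage ((\<lambda>d. (d, {})) ` N) W"
    using fin by (auto simp: linkage_def W_def N_def pairwise_def)
  moreover have "inj_on vertex_edge W" by (auto simp: inj_on_def vertex_edge_def doubleton_eq_iff)
  then have "card M = card N + card W"
    using fin by (simp add: N_def W_def card_image image_subset_iff card_Diff_subset card_mono
        flip: card_image)
  moreover have "card ((\<lambda>d. (d, {} :: 'v set)) ` N) = card N"
    by (intro card_image) (auto simp: inj_on_def)
  ultimately show thesis using that by metis
qed

text \<open>The links arriving at \<open>v\<close> are merged if there is one at each half of \<open>v\<close>, and dropped
  otherwise. If merging would close a cycle at a vertex \<open>w\<close>, both links are dropped instead; this is
  paid for by adding \<open>w\<close> as well as \<open>v\<close> to \<open>W\<close>.\<close>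

lemma linkage_extend:
  assumes F: "linkage F W" and v: "v \<in> verts B - X - W"
  obtains F' W' where "linkage F' W'" "W \<subset> W'" "card F + card W \<le> card F' + card W'"
proof -
  have fin: "finite F" "finite W" using F finite_verts finite_subset by (auto simp: linkage_def)
  have W: "W \<subseteq> verts B - X" using F by (simp add: linkage_def)
  have lk: "linked (fst p) (snd p)" "snd p \<subseteq> W" "fst ` fst p \<inter> W = {}" if "p \<in> F" for p
    using F that by (auto simp: linkage_def)
  have dj: "fst p \<inter> fst q = {}" "snd p \<inter> snd q = {}" if "p \<in> F" "q \<in> F" "p \<noteq> q" for p q
    using F that by (auto simp: linkage_def pairwise_def disjnt_def)
  have uniq: "p = q" if "p \<in> F" "q \<in> F" "a \<in> fst p" "a \<in> fst q" for p q a
    using dj that by blast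
  have sub: "linkage G (W \<union> Z)"
    if "G \<subseteq> F" "Z \<subseteq> verts B - X" "\<And>p. p \<in> G \<Longrightarrow> fst ` fst p \<inter> Z = {}" for G Z
  proof -
    have "linked (fst p) (snd p) \<and> snd p \<subseteq> W \<union> Z \<and> fst ` fst p \<inter> (W \<union> Z) = {}" if "p \<in> G" for p
      using lk[of p] that \<open>G \<subseteq> F\<close> \<open>\<And>p. p \<in> G \<Longrightarrow> fst ` fst p \<inter> Z = {}\<close>[of p] by blast
    moreover have "pairwise (\<lambda>p q. disjnt (fst p) (fst q) \<and> disjnt (snd p) (snd q)) G"
      using F \<open>G \<subseteq> F\<close> unfolding linkage_def by (blast intro: pairwise_subset)
    ultimately show ?thesis
      using fin(1) W that(1,2) finite_subset by (auto simp: linkage_def)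
  qed
  show thesis
  proof (cases "\<exists>s. \<forall>p\<in>F. (v, s) \<notin> fst p")
    \<comment> \<open>A half of \<open>v\<close> is free, so at most one link is dropped while
      \<open>W\<close> gains \<open>v\<close>.\<close>
    case True
    then obtain s where s: "\<And>p. p \<in> F \<Longrightarrow> (v, s) \<notin> fst p" by blast
    define G where "G = {p \<in> F. (v, opposite s) \<notin> fst p}"
    have "linkage G (W \<union> {v})"
    proof (rule sub)
      fix p assume p: "p \<in> G"
      have "(v, t) \<notin> fst p" for t
        using p s[of p] by (cases "t = s") (auto simp: G_def sign_neq_iff)
      then show "fst ` fst p \<inter> {v} = {}" by auto
    qed (use v in \<open>auto simp: G_def\<close>)
    moreover have "card F \<le> Suc (card G)"
    proof (cases "G = F")
      case False
      then obtain p where p: "p \<in> F" "(v, opposite s) \<in> fst p" by (auto simp: G_def)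
      then have "F \<subseteq> insert p G" using uniq[OF _ p(1) _ p(2)] unfolding G_def by blast
      then have "card F \<le> card (insert p G)" using fin by (intro card_mono) (auto simp: G_def)
      also have "\<dots> \<le> Suc (card G)" by (rule card_insert_le_m1) auto
      finally show ?thesis .
    qed simp
    ultimately show thesis using that[of G "W \<union> {v}"] v fin by auto
  next
    case False
    then obtain p q where p: "p \<in> F" "(v, Plus) \<in> fst p" and q: "q \<in> F" "(v, Minus) \<in> fst q"
      by blast
    obtain a where a: "fst p = {(v, Plus), a}" "link a (snd p) (v, Plus)"
      using linked_in[OF lk(1)[OF p(1)] p(2)] link_sym by metis
    obtain b where b: "fst q = {(v, Minus), b}" "link (v, Minus) (snd q) b"
      using linked_in[OF lk(1)[OF q(1)] q(2)] by metis
    \<comment> \<open>The ends of a link lie at distinct vertices, so the two halves of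
      \<open>v\<close> belong to different links.\<close>
    have "fst a \<noteq> v" "fst b \<noteq> v" using link_ends(1)[OF a(2)] link_ends(1)[OF b(2)] by auto
    then have "(v, Minus) \<notin> fst p" unfolding a(1) by auto
    then have "p \<noteq> q" using q(2) by blast
    have "a \<noteq> b" using dj(1)[OF p(1) q(1) \<open>p \<noteq> q\<close>] unfolding a(1) b(1) by blast
    have nW: "fst a \<notin> W" "fst b \<notin> W" using lk(3)[OF p(1)] lk(3)[OF q(1)] unfolding a(1) b(1) by auto
    let ?G = "F - {p, q}"
    have cG: "card F = card ?G + 2"
      using p(1) q(1) \<open>p \<noteq> q\<close> fin card_mono[of F "{p, q}"] by (simp add: card_Diff_subset)
    have other: "(v, s) \<notin> fst r" "a \<notin> fst r" "b \<notin> fst r" if "r \<in> ?G" for r s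
    proof -
      have "fst p \<inter> fst r = {}" "fst q \<inter> fst r = {}" 
        using dj(1)[OF p(1), of r] dj(1)[OF q(1), of r] that by blast+
      then show "(v, s) \<notin> fst r" "a \<notin> fst r" "b \<notin> fst r"
        unfolding a(1) b(1) by (cases s; auto)+
    qed
    show thesis
    proof (cases "fst a = fst b")
      case True
      define w where "w = fst a"
      have ab: "a \<in> halves" "b \<in> halves" "fst a = w" "fst b = w"
        using link_ends(2)[OF a(2)] link_ends(3)[OF b(2)] True by (auto simp: w_def)
      \<comment> \<open>Only vertices outside \<open>X\<close> have two halves. As \<open>a\<close>
        and \<open>b\<close> are both halves of \<open>w\<close>, no remaining link ends at
        \<open>w\<close>, and \<open>w\<close> can join \<open>W\<close>.\<close>
      then have w: "w \<in> verts B - X"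
        using \<open>a \<noteq> b\<close> by (auto simp: halves_def)
      have "snd b = opposite (snd a)"
        using \<open>a \<noteq> b\<close> ab by (metis prod_eqI sign_neq_iff)
      then have "(w, s) = a \<or> (w, s) = b" for s
        using ab by (metis prod.collapse sign_neq_iff)
      then have "(w, s) \<notin> fst r" if "r \<in> ?G" for r s using other[OF that] by metis
      then have "linkage ?G (W \<union> {v, w})"
        using other(1) v w by (intro sub) auto
      moreover have "w \<noteq> v" "w \<notin> W" using \<open>fst a \<noteq> v\<close> nW by (auto simp: w_def)
      then have "card (W \<union> {v, w}) = card W + 2" using v fin by simp
      ultimately show thesis using that[of ?G "W \<union> {v, w}"] v cG by auto
    next
      case False
      \<comment> \<open>Merging loses one link, which is balanced by adding \<open>v\<close> to
        \<open>W\<close>.\<close>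
      let ?l = "({a, b}, insert v (snd p \<union> snd q))"
      have "link a (insert v (snd p \<union> snd q)) b"
      proof (rule link_join[OF a(2) b(2)])
        show "insert (fst a) (snd p) \<inter> insert (fst b) (snd q) = {}"
          using False nW lk(2)[OF p(1)] lk(2)[OF q(1)] dj(2)[OF p(1) q(1) \<open>p \<noteq> q\<close>] by auto
      qed (use v in auto)
      then have "linked (fst ?l) (snd ?l)" unfolding linked_def fst_conv snd_conv by blast
      moreover have "snd ?l \<subseteq> W \<union> {v}" "fst ` fst ?l \<inter> (W \<union> {v}) = {}"
        using lk(2)[OF p(1)] lk(2)[OF q(1)] nW \<open>fst a \<noteq> v\<close> \<open>fst b \<noteq> v\<close> by auto
      moreover have "linkage ?G (W \<union> {v})"
        using other(1) v by (intro sub) auto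
      moreover have "disjnt (fst ?l) (fst r) \<and> disjnt (snd ?l) (snd r)" if "r \<in> ?G" for r
        using other[OF that] dj(2)[OF p(1), of r] dj(2)[OF q(1), of r] that lk(2)[of r] v
        by (auto simp: disjnt_def)
      ultimately have "linkage (insert ?l ?G) (W \<union> {v})"
        unfolding linkage_def pairwise_insert by (auto simp: disjnt_sym)
      moreover have "?l \<notin> ?G" using other(2) by fastforce
      then have "card (insert ?l ?G) = Suc (card ?G)" using fin by simp
      ultimately show thesis using that[of "insert ?l ?G" "W \<union> {v}"] v fin cG by auto
    qed
  qed
qed

text \<open>Once \<open>W\<close> is everything outside \<open>X\<close>, all ends of links lie in
  \<open>X\<close>, so the links are \<open>X\<close>-paths.\<close>

lemma linkage_complete:
  assumes "linkage F W"
  shows "\<exists>F'. linkage F' (verts B - X) \<and> card F + card W \<le> card F' + card (verts B - X)"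
  using assms
proof (induction "card (verts B - X - W)" arbitrary: F W rule: less_induct)
  case less
  show ?case
  proof (cases "verts B - X - W = {}")
    case True
    then have "W = verts B - X" using less.prems by (auto simp: linkage_def)
    then show ?thesis using less.prems by blast
  next
    case False
    then obtain v where "v \<in> verts B - X - W" by blast
    then obtain F' W' where F': "linkage F' W'" "W \<subset> W'" "card F + card W \<le> card F' + card W'"
      using linkage_extend[OF less.prems] by metis
    have "W' \<subseteq> verts B - X" using F'(1) by (simp add: linkage_def)
    then have "card (verts B - X - W') < card (verts B - X - W)"
      using finite_verts F'(2) by (intro psubset_card_mono) auto
    then show ?thesis using less.hyps[OF _ F'(1)] F'(3) by fastforce
  qed
qed

lemma disjoint_X_paths:
  assumes "matching split_edges M" "card (verts B - X) + k \<le> card M"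
  shows "\<exists>\<P>. finite \<P> \<and> card \<P> = k \<and> (\<forall>Q\<in>\<P>. is_X_path B X Q) \<and>
    pairwise (\<lambda>P Q. disjnt (path_verts P) (path_verts Q)) \<P>"
proof -
  obtain F W where "linkage F W" "card M = card F + card W"
    using linkage_from_matching[OF assms(1)] .
  then obtain F' where F': "linkage F' (verts B - X)" "card M \<le> card F' + card (verts B - X)"
    using linkage_complete by metis
  then have "k \<le> card F'" using assms(2) by simp
  then obtain G where G: "G \<subseteq> F'" "card G = k" "finite G"
    by (rule obtain_subset_with_card_n)
  have lk: "linked (fst p) (snd p)" "snd p \<subseteq> verts B - X" "fst ` fst p \<inter> (verts B - X) = {}"
    if "p \<in> G" for p
    using F'(1) G(1) that unfolding linkage_def by blast+
  have "pairwise (\<lambda>p q. disjnt (fst p) (fst q) \<and> disjnt (snd p) (snd q)) G"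
    using F'(1) G(1) unfolding linkage_def by (blast intro: pairwise_subset)
  then have dj: "fst p \<inter> fst q = {}" "snd p \<inter> snd q = {}" if "p \<in> G" "q \<in> G" "p \<noteq> q" for p q
    using pairwiseD[of _ G p q] that unfolding disjnt_def by blast+
  \<comment> \<open>A terminal has only one half, so links with disjoint end halves also have
    disjoint endvertices.\<close>
  have XPlus: "fst p \<subseteq> X \<times> {Plus}" if "p \<in> G" for p
    using linked_ends(2)[OF lk(1)] lk(3) that by (fastforce simp: halves_def)
  have "\<exists>Q. is_X_path B X Q \<and> path_verts Q = fst ` fst p \<union> snd p" if p: "p \<in> G" for p
  proof -
    obtain a b where ab: "fst p = {a, b}" "link a (snd p) b"
      using lk(1)[OF p] by (auto simp: linked_def)
    moreover have "fst a \<in> X" "fst b \<in> X" "snd p \<inter> X = {}"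
      using XPlus[OF p] lk(2)[OF p] ab(1) by auto
    ultimately show ?thesis using link_X_path[OF ab(2)] by simp
  qed
  then obtain f where f: "\<And>p. p \<in> G \<Longrightarrow> is_X_path B X (f p)"
      "\<And>p. p \<in> G \<Longrightarrow> path_verts (f p) = fst ` fst p \<union> snd p"
    by metis
  have disj: "disjnt (path_verts (f p)) (path_verts (f q))" if "p \<in> G" "q \<in> G" "p \<noteq> q" for p q
  proof -
    have "fst ` fst p \<inter> fst ` fst q = {}"
      using dj(1)[OF that] XPlus[OF that(1)] XPlus[OF that(2)] by fastforce
    moreover have "fst ` fst p \<subseteq> X" "fst ` fst q \<subseteq> X" using XPlus that by fastforce+
    ultimately show ?thesis
      using f(2) that dj(2)[OF that] lk(2)[OF that(1)] lk(2)[OF that(2)] by (auto simp: disjnt_def)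
  qed
  have "inj_on f G"
  proof (rule inj_onI, rule ccontr)
    fix p q assume pq: "p \<in> G" "q \<in> G" "f p = f q" "p \<noteq> q"
    then have "path_verts (f p) = {}" using disj[of p q] by simp
    then show False using f(2)[OF pq(1)] linked_ends(1)[OF lk(1)[OF pq(1)]] by auto
  qed
  then have "card (f ` G) = k" using G(2) by (simp add: card_image)
  moreover have "pairwise (\<lambda>P Q. disjnt (path_verts P) (path_verts Q)) (f ` G)"
    using disj by (auto simp: pairwise_def)
  ultimately show ?thesis using f(1) G(3) by (intro exI[of _ "f ` G"]) auto
qed

section \<open>A hitting set from a barrier\<close>

text \<open>For each class \<open>K\<close>, delete all but one of the vertices through which a path can enter or
  leave \<open>K\<close>. Along a path avoiding these vertices, every outgoing half-edge lies in a class whose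
  remaining boundary vertex the path has already used, so the path cannot end.\<close>

lemma hitting_set:
  assumes U: "U \<subseteq> halves" and P: "\<Union>P = halves - U" "pairwise disjnt P"
    and odd: "\<And>K. K \<in> P \<Longrightarrow> odd (card K)"
    and cross: "\<And>e. e \<in> split_edges \<Longrightarrow> e \<inter> U = {} \<Longrightarrow> \<exists>K\<in>P. e \<subseteq> K"
  obtains Y where "Y \<subseteq> verts B" "card Y + card P \<le> card X + card U"
    "\<nexists>Q. is_X_path (delete_verts B Y) X Q"
proof -
  \<comment> \<open>\<open>\<beta>\<close> consists of the halves through which a path can enter or
    leave their class; the vertices in \<open>Z\<close> lie entirely in the barrier.\<close>
  define \<beta> where "\<beta> = {p \<in> halves - U. fst p \<in> X \<or> flip p \<in> U}"
  define Z where "Z = {v \<in> X. (v, Plus) \<in> U} \<union> {v \<in> verts B - X. (v, Plus) \<in> U \<and> (v, Minus) \<in> U}"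
  have disj: "K = L" if "K \<in> P" "L \<in> P" "x \<in> K" "x \<in> L" for K L x
    using P(2) that unfolding pairwise_def disjnt_iff by blast
  have flip_class: "flip p \<in> K" if K: "K \<in> P" "p \<in> K" and p: "fst p \<notin> X" "flip p \<notin> U" for K p
  proof -
    have h: "p \<in> halves" "p \<notin> U" using K P(1) by auto
    then have "fst p \<in> verts B - X" using p(1) by (auto simp: halves_def)
    then have "{p, flip p} \<in> split_edges"
      unfolding split_edges_def using vertex_edge_flip[OF p(1)] by blast
    then obtain L where "L \<in> P" "{p, flip p} \<subseteq> L" using cross h(2) p(2) by blast
    then show ?thesis using disj[OF K(1), of L p] K(2) by auto
  qed
  \<comment> \<open>Otherwise \<open>flip\<close> would pair up the halves in \<open>K\<close>,
    contradicting that \<open>card K\<close> is odd. So each class has a boundary half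
    \<open>rep K\<close> to spare.\<close>
  have "K \<inter> \<beta> \<noteq> {}" if K: "K \<in> P" for K
  proof
    assume "K \<inter> \<beta> = {}"
    have KU: "K \<subseteq> halves - U" using K P(1) by blast
    then have free: "fst p \<notin> X" "flip p \<notin> U" if "p \<in> K" for p
      using that \<open>K \<inter> \<beta> = {}\<close> by (auto simp: \<beta>_def)
    let ?K = "{p \<in> K. snd p = Plus}"
    have "finite K" using KU finite_halves finite_subset by blast
    have "bij_betw flip ?K (K - ?K)"
    proof (rule bij_betw_byWitness[where f' = flip])
      show "\<forall>p\<in>?K. flip (flip p) = p" "\<forall>p\<in>K - ?K. flip (flip p) = p"
        using flip_flip KU by auto
      have "snd (flip p) = opposite (snd p)" if "p \<in> K" for p
        using free(1)[OF that] by (simp add: flip_def)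
      then show "flip ` ?K \<subseteq> K - ?K" "flip ` (K - ?K) \<subseteq> ?K"
        using flip_class[OF K] free by (auto simp: sign_neq_iff)
    qed
    then have "card ?K = card (K - ?K)" by (rule bij_betw_same_card)
    also have "\<dots> = card K - card ?K" using \<open>finite K\<close> by (intro card_Diff_subset) auto
    finally have "card K = 2 * card ?K"
      using card_mono[OF \<open>finite K\<close>, of ?K] by simp
    then show False using odd[OF K] by simp
  qed
  then have "\<forall>K\<in>P. \<exists>p. p \<in> K \<inter> \<beta>" by blast
  then obtain rep where rep: "\<And>K. K \<in> P \<Longrightarrow> rep K \<in> K \<inter> \<beta>" by metis
  define Y where "Y = Z \<union> fst ` (\<beta> - rep ` P)"
  have fin: "finite \<beta>" "finite U" using finite_halves U finite_subset by (auto simp: \<beta>_def)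
  have "inj_on rep P" using rep disj by (intro inj_onI) (metis IntD1)
  moreover have "rep ` P \<subseteq> \<beta>" using rep by auto
  ultimately have "card (\<beta> - rep ` P) + card P = card \<beta>"
    using fin by (metis card_Diff_subset card_image card_mono finite_subset le_add_diff_inverse2)
  moreover have "card Y \<le> card Z + card (\<beta> - rep ` P)"
    unfolding Y_def using fin by (meson add_left_mono card_Un_le card_image_le finite_Diff le_trans)
  \<comment> \<open>Boundary halves at terminals number at most \<open>card X\<close>. The others
    are mapped injectively into \<open>U\<close> by \<open>flip\<close>, and miss
    \<open>Z \<times> {Plus}\<close> because their partners lie outside \<open>U\<close>.\<close>
  moreover have "card \<beta> + card Z \<le> card X + card U"
  proof -
    let ?b = "{p \<in> \<beta>. fst p \<notin> X}" and ?bX = "{p \<in> \<beta>. fst p \<in> X}"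
    have "card ?bX \<le> card (X \<times> {Plus})"
      using finite_X by (intro card_mono) (auto simp: \<beta>_def halves_def)
    moreover have "card \<beta> = card ?b + card ?bX"
      using fin(1) by (subst card_Un_disjoint[symmetric]) (auto intro: arg_cong[where f = card])
    moreover have "card ?b + card Z \<le> card U"
    proof -
      have "inj_on flip ?b" by (rule inj_on_inverseI[where g = flip]) (auto simp: \<beta>_def flip_flip)
      then have "card (flip ` ?b) = card ?b" by (rule card_image)
      moreover have "card (Z \<times> {Plus}) = card Z" by (simp add: card_cartesian_product)
      moreover have sub: "flip ` ?b \<subseteq> U" "Z \<times> {Plus} \<subseteq> U" by (auto simp: \<beta>_def Z_def)
      moreover have "flip ` ?b \<inter> (Z \<times> {Plus}) = {}"
      proof (intro Int_emptyI, elim imageE)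
        fix p q assume "p \<in> Z \<times> {Plus}" "p = flip q" and q: "q \<in> ?b"
        then have "fst q \<in> Z" "fst q \<notin> X" by (auto simp: mem_Times_iff)
        then have "(fst q, s) \<in> U" for s by (cases s) (auto simp: Z_def)
        then have "q \<in> U" by (metis prod.collapse)
        then show False using q by (auto simp: \<beta>_def)
      qed
      moreover have "finite (flip ` ?b)" "finite (Z \<times> {Plus})"
        using sub fin(2) finite_subset by blast+
      ultimately have "card ?b + card Z = card (flip ` ?b \<union> Z \<times> {Plus})"
        by (simp only: card_Un_disjoint)
      then show ?thesis using sub fin(2) by (simp only: card_mono Un_least)
    qed
    ultimately show ?thesis by (simp add: card_cartesian_product)
  qed
  ultimately have "card Y + card P \<le> card X + card U" by linarith
  moreover have "Y \<subseteq> verts B" using X_verts by (auto simp: Y_def Z_def \<beta>_def halves_def)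
  moreover have False if Q: "is_X_path (delete_verts B Y) X Q" for Q
  proof -
    obtain vs es where "Q = (vs, es)" by (cases Q)
    then have path: "is_path (delete_verts B Y) (vs, es)" and es: "es \<noteq> []"
      and X: "hd vs \<in> X" "last vs \<in> X" "\<forall>v \<in> set vs - {hd vs, last vs}. v \<notin> X"
      using Q by (auto simp: is_X_path_def)
    let ?s = "\<lambda>i j. signing B (vs ! i) (es ! j)"
    have len: "length vs = Suc (length es)" and "distinct vs"
      and vsY: "set vs \<subseteq> verts B - Y" and E: "set es \<subseteq> edges B"
      and en: "\<And>i. i < length es \<Longrightarrow> ends B (es ! i) = {vs ! i, vs ! Suc i}"
      and sg: "\<And>i. Suc i < length es \<Longrightarrow> ?s (Suc i) i \<noteq> ?s (Suc i) (Suc i)"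
      using path by (auto simp: is_path_iff delete_verts_def)
    then have "vs \<noteq> []" by auto
    then have hd: "hd vs = vs ! 0" and last: "last vs = vs ! length es"
      using len by (simp_all add: hd_conv_nth last_conv_nth)
    have nY: "vs ! i \<in> verts B" "vs ! i \<notin> Y" if "i \<le> length es" for i
      using vsY that len by (auto simp: subset_iff)
    \<comment> \<open>A boundary half whose vertex survives must be the spared one of its
      class.\<close>
    have boundary: "p = rep K" if p: "p \<in> \<beta>" "fst p \<notin> Y" and K: "K \<in> P" "p \<in> K" for p K
    proof -
      obtain L where "L \<in> P" "p = rep L" using p by (auto simp: Y_def)
      then show ?thesis using rep[of L] disj[OF K(1), of L p] K(2) by auto
    qed
    have step: "half (vs ! Suc i) (?s (Suc i) i) \<in> K"
      if i: "i < length es" and K: "K \<in> P" "half (vs ! i) (?s i i) \<in> K"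
        and nU: "half (vs ! Suc i) (?s (Suc i) i) \<notin> U" for i K
    proof -
      let ?d = "{half (vs ! i) (?s i i), half (vs ! Suc i) (?s (Suc i) i)}"
      have "?d \<in> split_edges" using en[OF i] i E unfolding split_edges_def by fastforce
      moreover have "?d \<inter> U = {}" using K P(1) nU by blast
      ultimately obtain L where "L \<in> P" "?d \<subseteq> L" using cross by blast
      then show ?thesis using disj[OF K(1), of L "half (vs ! i) (?s i i)"] K(2) by auto
    qed
    have new: "vs ! Suc i \<noteq> vs ! j" if "i < length es" "j \<le> i" for i j
      using that \<open>distinct vs\<close> len by (simp add: nth_eq_iff_index_eq)
    have X_nU: "half v s \<notin> U" if "v \<in> X" "v \<notin> Y" for v s
      using that by (auto simp: Y_def Z_def half_X)
    have inv: "\<exists>K\<in>P. half (vs ! i) (?s i i) \<in> K \<and> (\<exists>j\<le>i. fst (rep K) = vs ! j)"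
      if "i < length es" for i
      using that
    proof (induction i)
      case 0
      let ?h = "half (vs ! 0) (?s 0 0)"
      have "?h \<notin> U" using X_nU X(1) nY[of 0] hd by simp
      moreover have "?h \<in> halves" using nY[of 0] by simp
      ultimately obtain K where K: "K \<in> P" "?h \<in> K" using P(1) by blast
      have "?h \<in> \<beta>" using \<open>?h \<notin> U\<close> \<open>?h \<in> halves\<close> X(1) hd by (simp add: \<beta>_def)
      then have "?h = rep K" using boundary K nY[of 0] by simp
      then show ?case using K by (metis fst_half le_refl)
    next
      case (Suc i)
      then obtain K j where K: "K \<in> P" "half (vs ! i) (?s i i) \<in> K" "j \<le> i" "fst (rep K) = vs ! j"
        by auto
      let ?v = "vs ! Suc i" and ?s = "?s (Suc i) i" and ?t = "?s (Suc i) (Suc i)"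
      have v: "?v \<in> verts B" "?v \<notin> Y" using nY Suc.prems by auto
      have "?v \<noteq> hd vs" "?v \<noteq> last vs"
        using \<open>distinct vs\<close> len Suc.prems by (simp_all add: hd last nth_eq_iff_index_eq)
      then have vX: "?v \<notin> X" using X(3) Suc.prems len by simp
      have st: "?t = opposite ?s" using sg[OF Suc.prems] by (simp add: sign_neq_iff)
      have fl: "flip (?v, ?s) = (?v, ?t)" "flip (?v, ?t) = (?v, ?s)"
        using vX st by (auto simp: flip_def)
      have hv: "(?v, s) \<in> halves" for s using v(1) vX by (simp add: halves_def)
      show ?case
      proof (cases "(?v, ?s) \<in> U")
        \<comment> \<open>The path arrives in the barrier. Since \<open>?v\<close> is not in
          \<open>Z\<close>, the outgoing half is a boundary half, hence the representative of its
          own class, and sits at the current vertex.\<close>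
        case True
        have "(?v, ?t) \<notin> U"
        proof
          assume "(?v, ?t) \<in> U"
          then have "(?v, s) \<in> U" for s using True st by (metis sign_neq_iff)
          then show False using v vX by (auto simp: Y_def Z_def)
        qed
        then obtain L where L: "L \<in> P" "(?v, ?t) \<in> L" using P(1) hv by blast
        have "(?v, ?t) \<in> \<beta>" using True fl(2) hv \<open>(?v, ?t) \<notin> U\<close> by (simp add: \<beta>_def)
        then have "(?v, ?t) = rep L" using boundary L v(2) by simp
        then have "fst (rep L) = ?v" by (metis fst_conv)
        then show ?thesis using L vX by auto
      next
        \<comment> \<open>The path arrives within \<open>K\<close>. If the outgoing half were in
          \<open>U\<close>, the arriving one would be \<open>rep K\<close>, which sits at an earlier
          vertex. So the path stays in \<open>K\<close>.\<close>
        case False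
        then have sK: "(?v, ?s) \<in> K" using step[OF _ K(1,2)] Suc.prems vX by simp
        have "(?v, ?t) \<notin> U"
        proof
          assume "(?v, ?t) \<in> U"
          then have "(?v, ?s) \<in> \<beta>" using False fl(1) hv by (simp add: \<beta>_def)
          then have "(?v, ?s) = rep K" using boundary K(1) sK v(2) by simp
          then have "?v = vs ! j" using K(4) by (metis fst_conv)
          then show False using new[of i j] K(3) Suc.prems by simp
        qed
        then have "(?v, ?t) \<in> K" using flip_class[OF K(1) sK] fl(1) vX by simp
        then show ?thesis using K vX by (metis half_not_X le_SucI)
      qed
    qed
    obtain i where i: "length es = Suc i" using es by (cases es) auto
    then obtain K j where K: "K \<in> P" "half (vs ! i) (?s i i) \<in> K" "j \<le> i" "fst (rep K) = vs ! j"
      using inv[of i] by auto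
    \<comment> \<open>The last vertex is a terminal, so its half is a boundary half of
      \<open>K\<close> and must be \<open>rep K\<close>; but that sits at an earlier vertex.\<close>
    let ?h = "half (vs ! Suc i) (?s (Suc i) i)"
    have "vs ! Suc i \<in> X" "vs ! Suc i \<in> verts B" "vs ! Suc i \<notin> Y"
      using X(2) last i nY[of "Suc i"] by auto
    then have "?h \<in> \<beta>" "?h \<notin> U" using X_nU[of "vs ! Suc i"] half_in_halves by (auto simp: \<beta>_def)
    then have "?h = rep K"
      using boundary K(1) step[of i K] K(2) i \<open>vs ! Suc i \<notin> Y\<close> by simp
    then have "vs ! Suc i = vs ! j" using K(4) by (metis fst_half)
    then show False using new[of i j] K(3) i by simp
  qed
  ultimately show thesis using that by blast
qed

end

section \<open>Disjoint paths or a small hitting set\<close>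

theorem theorem4p1:
  fixes B :: "('v, 'e) bidirected_multigraph" and X :: "'v set" and k :: nat
  assumes "bidirected B" and "X \<subseteq> verts B"
  shows "(\<exists>\<P>. finite \<P> \<and> card \<P> = k \<and> (\<forall>P \<in> \<P>. is_X_path B X P) \<and>
              pairwise (\<lambda>P Q. disjnt (path_verts P) (path_verts Q)) \<P>) \<or>
         (\<exists>Y \<subseteq> verts B. int (card Y) \<le> 2 * int k - 2 \<and>
              (\<nexists>P. is_X_path (delete_verts B Y) X P))"
proof -
  interpret terminals B X using assms by unfold_locales
  interpret finite_graph halves split_edges by (rule finite_graph_split)
  obtain M where M: "max_matching split_edges M"
    using max_matching_exists[OF finite_E] .
  show ?thesis
  proof (cases "card (verts B - X) + k \<le> card M")
    case True
    moreover have "matching split_edges M" using M by (simp add: max_matching_def)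
    ultimately show ?thesis by (intro disjI1 disjoint_X_paths)
  next
    case False
    obtain U P where UP: "U \<subseteq> halves" "\<Union>P = halves - U" "pairwise disjnt P"
      "\<And>K. K \<in> P \<Longrightarrow> odd (card K)" "\<And>e. e \<in> split_edges \<Longrightarrow> e \<inter> U = {} \<Longrightarrow> \<exists>K\<in>P. e \<subseteq> K"
      and eq: "card halves + card U = 2 * card M + card P"
      using Tutte_Berge[OF finite_graph_split M] by meson
    obtain Y where Y: "Y \<subseteq> verts B" "card Y + card P \<le> card X + card U"
      "\<nexists>Q. is_X_path (delete_verts B Y) X Q"
      using hitting_set[OF UP] by blast
    \<comment> \<open>With \<open>n = card (verts B - X)\<close>, the formula gives
      \<open>card X + card U - card P = 2 * card M - 2 * n\<close>, and
      \<open>card M \<le> n + k - 1\<close>.\<close>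
    have "int (card Y) \<le> 2 * int k - 2"
      using False Y(2) eq card_halves by linarith
    then show ?thesis using Y(1,3) by blast
  qed
qed

end
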